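(* Let $(\Omega,d)$ be a proper CAT(0) space equipped with an isometric action of a group $G$, and let $M$ be a closed $G$-orbit in $\Omega$, regarded as a proper metric space with the restriction of $d$. Assume that there exists a constant $b\ge 0$ such that for any $p,q\in M$ there exists a geodesic ray $c$ in $\Omega$ issuing from $p$ such that $d(q,c):=\min_{t\in[0,\infty)}d(q,c(t))\le b$ and the action of $P_{c(\infty)}$ on $M$ is transitive. Then the $G$-space $M$ has Property (S).
   Context: Proper metric space: a metric space in which every closed ball is compact. CAT(0) spaces are geodesic metric spaces satisfying the usual comparison inequality with Euclidean triangles. A geodesic ray issuing from $c(0)$ is an isometric map $c:[0,\infty)\to\Omega$. Two geodesic rays $c,c'$ are asymptotic if there is $a\ge0$ with $d(c(t),c'(t))\le a$ for all $t\in[0,\infty)$. The boundary $\partial\Omega$ is the set of asymptoty classes of geodesic rays; the class of $c$ is denoted $c(\infty)$. Each isometric action of $G$ on $\Omega$ induces an action on the set $\partial\Omega$, and for $\xi\in\partial\Omega$ we put $P_\xi:=\{g\in G\mid g\cdot\xi=\xi\}$. Property (S) for the metric $G$-space $M$: for each $r\ge 0$ there exists $\tau(r)\ge 0$ such that for any $p_0,p,q\in M$ with $d(p,p_0)\le r$ one can choose $g\in G$ with $g\cdot p=p_0$ and $d(q,g\cdot q)\le\tau(r)$. *)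

theory Defs
  imports "HOL-Analysis.Analysis" "HOL-Algebra.Group_Action"
begin

text \<open>The space \<open>\<Omega>\<close> is the universe of a type \<^typ>\<open>'a\<close> of class \<^class>\<open>metric_space\<close>.\<close>

definition proper_space :: "'a::metric_space itself \<Rightarrow> bool" where
  "proper_space _ \<longleftrightarrow> (\<forall>(x::'a) r. compact (cball x r))"


subsection \<open>CAT(0) spaces\<close>

definition geodesic :: "'a::metric_space \<Rightarrow> 'a \<Rightarrow> (real \<Rightarrow> 'a) \<Rightarrow> bool" where
  "geodesic p q c \<longleftrightarrow> c 0 = p \<and> c (dist p q) = q \<and>
     (\<forall>s\<in>{0..dist p q}. \<forall>t\<in>{0..dist p q}. dist (c s) (c t) = \<bar>s - t\<bar>)"

definition geodesic_space :: "'a::metric_space itself \<Rightarrow> bool" where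
  "geodesic_space _ \<longleftrightarrow> (\<forall>p q::'a. \<exists>c. geodesic p q c)"

text \<open>The pairs \<open>(x, x')\<close> of a point \<open>x\<close> on the side \<open>c\<close> from \<open>p\<close> to \<open>q\<close> and its comparison
  point \<open>x'\<close> on the Euclidean segment from \<open>p'\<close> to \<open>q'\<close>, assuming
  \<open>dist p' q' = dist p q\<close>.\<close>

definition comparison_pairs ::
  "'a::metric_space \<Rightarrow> 'a \<Rightarrow> (real \<Rightarrow> 'a) \<Rightarrow> real^2 \<Rightarrow> real^2 \<Rightarrow> ('a \<times> (real^2)) set" where
  "comparison_pairs p q c p' q' =
     {(c s, x') | s x'. s \<in> {0..dist p q} \<and> x' \<in> closed_segment p' q' \<and> dist p' x' = s}"

definition CAT0_space :: "'a::metric_space itself \<Rightarrow> bool" where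
  "CAT0_space T \<longleftrightarrow> geodesic_space T \<and>
     (\<forall>(p::'a) q r c1 c2 c3 (p'::real^2) q' r'.
        geodesic p q c1 \<longrightarrow> geodesic q r c2 \<longrightarrow> geodesic r p c3 \<longrightarrow>
        dist p' q' = dist p q \<longrightarrow> dist q' r' = dist q r \<longrightarrow> dist r' p' = dist r p \<longrightarrow>
        (let \<Delta> = comparison_pairs p q c1 p' q' \<union> comparison_pairs q r c2 q' r'
                  \<union> comparison_pairs r p c3 r' p'
         in \<forall>(x, x')\<in>\<Delta>. \<forall>(y, y')\<in>\<Delta>. dist x y \<le> dist x' y'))"


subsection \<open>Geodesic rays and the boundary\<close>

text \<open>Only the restriction of a ray to \<open>[0,\<infinity>)\<close> is relevant; its values at negative arguments
  are arbitrary, and asymptoty identifies all choices.\<close>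

definition geodesic_ray :: "(real \<Rightarrow> 'a::metric_space) \<Rightarrow> bool" where
  "geodesic_ray c \<longleftrightarrow> (\<forall>s\<ge>0. \<forall>t\<ge>0. dist (c s) (c t) = \<bar>s - t\<bar>)"

definition asymptotic_rel :: "((real \<Rightarrow> 'a::metric_space) \<times> (real \<Rightarrow> 'a)) set" where
  "asymptotic_rel = {(c, c'). geodesic_ray c \<and> geodesic_ray c' \<and>
     (\<exists>a\<ge>0. \<forall>t\<ge>0. dist (c t) (c' t) \<le> a)}"

definition boundary_at_infinity :: "(real \<Rightarrow> 'a::metric_space) set set" where
  "boundary_at_infinity = Collect geodesic_ray // asymptotic_rel"

definition ray_end :: "(real \<Rightarrow> 'a::metric_space) \<Rightarrow> (real \<Rightarrow> 'a) set" where
  "ray_end c = asymptotic_rel `` {c}"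

lemma ray_end_in_boundary: "geodesic_ray c \<Longrightarrow> ray_end c \<in> boundary_at_infinity"
  by (simp add: ray_end_def boundary_at_infinity_def quotientI)

text \<open>The distance \<open>d(q,c)\<close> from a point to a ray is rendered as the library's
  \<^term>\<open>infdist q (c ` {0..})\<close>; the infimum is a minimum.\<close>

lemma infdist_geodesic_ray_attained:
  assumes "geodesic_ray c"
  shows "\<exists>t\<ge>0. infdist q (c ` {0..}) = dist q (c t) \<and> (\<forall>s\<ge>0. dist q (c t) \<le> dist q (c s))"
proof -
  let ?f = "\<lambda>t. dist q (c t)"
  have c: "dist (c s) (c t) = \<bar>s - t\<bar>" if "s \<ge> 0" "t \<ge> 0" for s t
    using assms that by (simp add: geodesic_ray_def)
  have lip: "1-lipschitz_on {0..} c"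
    by (rule lipschitz_onI) (auto simp: c dist_real_def)
  have cont: "continuous_on {0..2 * ?f 0} ?f"
    by (intro continuous_intros continuous_on_subset[OF lipschitz_on_continuous_on[OF lip]]) auto
  obtain t where t: "t \<in> {0..2 * ?f 0}" "\<forall>s\<in>{0..2 * ?f 0}. ?f t \<le> ?f s"
    using continuous_attains_inf[OF _ _ cont] by auto
  have min: "?f t \<le> ?f s" if "s \<ge> 0" for s
  proof (cases "s \<le> 2 * ?f 0")
    case True
    then show ?thesis using t that by auto
  next
    case False
    have "s \<le> ?f 0 + ?f s"
      using c[of 0 s] that dist_triangle[of "c 0" "c s" q] by (simp add: dist_commute)
    then show ?thesis using False t(2)[rule_format, of 0] by auto
  qed
  have "infdist q (c ` {0..}) = ?f t"
  proof (rule antisym)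
    show "infdist q (c ` {0..}) \<le> ?f t" using t by (intro infdist_le) auto
    show "?f t \<le> infdist q (c ` {0..})"
      unfolding infdist_def using min by (auto intro!: cINF_greatest)
  qed
  then show ?thesis using t min by auto
qed


subsection \<open>Isometric actions\<close>

definition isometric_action :: "('g, 'm) monoid_scheme \<Rightarrow> ('g \<Rightarrow> 'a::metric_space \<Rightarrow> 'a) \<Rightarrow> bool" where
  "isometric_action G \<phi> \<longleftrightarrow> group_action G UNIV \<phi> \<and>
     (\<forall>g\<in>carrier G. \<forall>x y. dist (\<phi> g x) (\<phi> g y) = dist x y)"

text \<open>The induced action on the boundary, \<open>g \<cdot> c(\<infinity>) = (g \<cdot> c)(\<infinity>)\<close>: as \<open>g\<close> acts
  bijectively, the translates of all members of a class form exactly a class.\<close>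

definition boundary_action ::
  "('g \<Rightarrow> 'a::metric_space \<Rightarrow> 'a) \<Rightarrow> 'g \<Rightarrow> (real \<Rightarrow> 'a) set \<Rightarrow> (real \<Rightarrow> 'a) set" where
  "boundary_action \<phi> g \<xi> = (\<lambda>c. \<phi> g \<circ> c) ` \<xi>"

lemma boundary_action_ray_end:
  fixes \<phi> :: "'g \<Rightarrow> 'a::metric_space \<Rightarrow> 'a"
  assumes act: "isometric_action G \<phi>" and g: "g \<in> carrier G"
  shows "boundary_action \<phi> g (ray_end c) = ray_end (\<phi> g \<circ> c)"
proof -
  interpret group_action G UNIV \<phi>
    using act by (simp add: isometric_action_def)
  have iso: "dist (\<phi> g x) (\<phi> g y) = dist x y" for x y
    using act g by (simp add: isometric_action_def)
  have "bij (\<phi> g)"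
    using bij_prop0[OF g] by (simp add: Bij_def)
  then have inv: "\<phi> g \<circ> (inv_into UNIV (\<phi> g) \<circ> c') = c'" for c' :: "real \<Rightarrow> 'a"
    by (auto simp: fun_eq_iff bij_is_surj surj_f_inv_f)
  have rel: "(\<phi> g \<circ> c, \<phi> g \<circ> c') \<in> asymptotic_rel \<longleftrightarrow> (c, c') \<in> asymptotic_rel" for c c'
    by (simp add: asymptotic_rel_def geodesic_ray_def iso)
  show ?thesis
  proof (rule Set.set_eqI)
    fix c'
    have "c' \<in> boundary_action \<phi> g (ray_end c) \<longleftrightarrow> (\<exists>c0. (c, c0) \<in> asymptotic_rel \<and> c' = \<phi> g \<circ> c0)"
      by (auto simp: boundary_action_def ray_end_def)
    also have "\<dots> \<longleftrightarrow> (\<phi> g \<circ> c, c') \<in> asymptotic_rel"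
      using rel inv by metis
    finally show "c' \<in> boundary_action \<phi> g (ray_end c) \<longleftrightarrow> c' \<in> ray_end (\<phi> g \<circ> c)"
      by (simp add: ray_end_def)
  qed
qed

definition acts_transitively :: "'g set \<Rightarrow> ('g \<Rightarrow> 'a \<Rightarrow> 'a) \<Rightarrow> 'a set \<Rightarrow> bool" where
  "acts_transitively H \<phi> M \<longleftrightarrow> (\<forall>x\<in>M. \<forall>y\<in>M. \<exists>h\<in>H. \<phi> h x = y)"

definition property_S ::
  "('g, 'm) monoid_scheme \<Rightarrow> ('g \<Rightarrow> 'a::metric_space \<Rightarrow> 'a) \<Rightarrow> 'a set \<Rightarrow> bool" where
  "property_S G \<phi> M \<longleftrightarrow>
     (\<forall>r\<ge>0. \<exists>\<tau>\<ge>0. \<forall>p0\<in>M. \<forall>p\<in>M. \<forall>q\<in>M. dist p p0 \<le> r \<longrightarrow>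
        (\<exists>g\<in>carrier G. \<phi> g p = p0 \<and> dist q (\<phi> g q) \<le> \<tau>))"

end

theory Submission
  imports Defs
begin

text \<open>
  Given \<open>p\<close>, \<open>p0\<close> and \<open>q\<close>, let \<open>c\<close> be a ray from \<open>p\<close> that passes within \<open>b\<close> of \<open>q\<close>, and
  let \<open>h\<close> fix \<open>c(\<infinity>)\<close> and move \<open>p\<close> to \<open>p0\<close>. Then \<open>c\<close> and its translate \<open>h \<circ> c\<close> are
  asymptotic. In a CAT(0) space the distance between two unit-speed geodesics is a convex
  function of time (\<open>CAT0_convex_dist\<close>), and a bounded convex function on \<open>[0,\<infinity>)\<close> cannot
  increase; hence \<open>h\<close> displaces every point of \<open>c\<close> by at most \<open>dist p p0 \<le> r\<close>
  (\<open>CAT0_asymptotic_dist_le\<close>). Since \<open>q\<close> lies within \<open>b\<close> of such a point, \<open>h\<close>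
  displaces \<open>q\<close> by at most \<open>2 * b + r\<close>.

  Convexity of the distance comes from the intercept inequality \<open>CAT0_intercept\<close> for two
  geodesics with a common origin, applied to the two triangles into which a diagonal cuts
  the quadrilateral spanned by the geodesics.
\<close>

lemma comparison_triangle_exists:
  fixes p q r :: "'a::metric_space"
  obtains p' q' r' :: "real^2"
  where "dist p' q' = dist p q" "dist q' r' = dist q r" "dist r' p' = dist r p"
proof -
  define a b c where "a = dist p q" and "b = dist r p" and "c = dist q r"
  have tri: "a \<ge> 0" "b \<ge> 0" "c \<ge> 0" "c \<le> a + b" "b \<le> a + c" "a \<le> b + c"
    using dist_triangle[of q r p] dist_triangle[of r p q] dist_triangle[of p q r]
    by (auto simp: a_def b_def c_def dist_commute)
  \<comment> \<open>Place \<open>p'\<close> at the origin and \<open>q'\<close> at \<open>(a, 0)\<close>; by the law of cosines \<open>x\<close> is then the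
    first coordinate of \<open>r'\<close>, and the triangle inequality says that \<open>\<bar>x\<bar> \<le> b\<close>. If \<open>p = q\<close>,
    every point at distance \<open>b\<close> from the origin can serve as \<open>r'\<close>.\<close>
  define x where "x = (if a = 0 then b else (a\<^sup>2 + b\<^sup>2 - c\<^sup>2) / (2 * a))"
  have cos_law: "2 * a * x = a\<^sup>2 + b\<^sup>2 - c\<^sup>2"
    using tri by (auto simp: x_def)
  have "\<bar>x\<bar> \<le> b"
  proof (cases "a = 0")
    case False
    have "c\<^sup>2 \<le> (a + b)\<^sup>2" "(a - b)\<^sup>2 \<le> c\<^sup>2"
      using tri by (auto intro!: power_mono simp: abs_le_square_iff[symmetric])
    then have "2 * a * x \<le> 2 * a * b" "2 * a * (- b) \<le> 2 * a * x"
      using cos_law by (auto simp: power2_eq_square algebra_simps)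
    moreover have "2 * a > 0" using False tri by simp
    ultimately have "x \<le> b" "- b \<le> x"
      using mult_le_cancel_left_pos by blast+
    then show ?thesis by simp
  qed (use tri in \<open>simp add: x_def\<close>)
  then have "x\<^sup>2 \<le> b\<^sup>2" using abs_le_square_iff[of x b] tri by simp
  define y where "y = sqrt (b\<^sup>2 - x\<^sup>2)"
  have y: "y\<^sup>2 = b\<^sup>2 - x\<^sup>2" using \<open>x\<^sup>2 \<le> b\<^sup>2\<close> by (simp add: y_def)
  have dist2: "dist u v = sqrt ((u$1 - v$1)\<^sup>2 + (u$2 - v$2)\<^sup>2)" for u v :: "real^2"
    by (simp add: dist_vec_def L2_set_def sum_2 dist_real_def)
  have "(a - x)\<^sup>2 + y\<^sup>2 = c\<^sup>2" using y cos_law by (simp add: power2_diff)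
  then show ?thesis
    using that[of "vector [0, 0]" "vector [a, 0]" "vector [x, y]"] y tri
    by (simp add: dist2 a_def[symmetric] b_def[symmetric] c_def[symmetric])
qed

lemma geodesic_reverse:
  assumes "geodesic p q c"
  shows "geodesic q p (\<lambda>s. c (dist p q - s))"
  using assms unfolding geodesic_def by (auto simp: dist_commute)

lemma geodesic_ray_imp_geodesic:
  assumes "geodesic_ray c" "T \<ge> 0"
  shows "dist (c 0) (c T) = T" "geodesic (c 0) (c T) c"
  using assms by (auto simp: geodesic_ray_def geodesic_def)

text \<open>In the Euclidean plane, contracting the two sides at \<open>p\<close> by the factor \<open>u\<close> contracts
  the opposite side by the same factor (the intercept theorem); comparison turns this
  equality into an inequality.\<close>

lemma CAT0_intercept:
  fixes p q r :: "'a::metric_space"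
  assumes cat: "CAT0_space TYPE('a)"
    and c: "geodesic p q c" and e: "geodesic p r e"
    and u: "0 \<le> u" "u \<le> 1"
  shows "dist (c (u * dist p q)) (e (u * dist p r)) \<le> u * dist q r"
proof -
  obtain p' q' r' :: "real^2"
    where d: "dist p' q' = dist p q" "dist q' r' = dist q r" "dist r' p' = dist r p"
    by (rule comparison_triangle_exists)
  obtain f where f: "geodesic q r f"
    using cat unfolding CAT0_space_def geodesic_space_def by blast
  \<comment> \<open>Comparison is phrased for a cyclically oriented triangle, so the side \<open>e\<close> is run
    through backwards.\<close>
  define e' where "e' s = e (dist p r - s)" for s
  have e': "geodesic r p e'"
    using geodesic_reverse[OF e] by (simp add: e'_def[abs_def])
  define x' where "x' = p' + u *\<^sub>R (q' - p')"
  define y' where "y' = p' + u *\<^sub>R (r' - p')"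
  have "dist p' x' = u * dist p' q'"
    using u by (simp add: x'_def dist_norm norm_minus_commute)
  moreover have "x' \<in> closed_segment p' q'"
    using u by (auto simp: x'_def in_segment algebra_simps)
  ultimately have x: "(c (u * dist p q), x') \<in> comparison_pairs p q c p' q'"
    using u d by (auto simp: comparison_pairs_def intro!: mult_left_le_one_le exI[of _ x'])
  have "r' - y' = (1 - u) *\<^sub>R (r' - p')"
    by (simp add: y'_def algebra_simps)
  then have "dist r' y' = (1 - u) * dist r' p'"
    using u by (simp add: dist_norm)
  moreover have "y' \<in> closed_segment r' p'"
    using u by (auto simp: y'_def in_segment algebra_simps intro!: exI[of _ "1 - u"])
  moreover have "e (u * dist p r) = e' ((1 - u) * dist r p)"
    by (simp add: e'_def dist_commute algebra_simps)
  ultimately have y: "(e (u * dist p r), y') \<in> comparison_pairs r p e' r' p'"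
    using u d by (auto simp: comparison_pairs_def mult_left_le_one_le
        intro!: exI[of _ "(1 - u) * dist r p"])
  have "x' - y' = u *\<^sub>R (q' - r')"
    by (simp add: x'_def y'_def algebra_simps)
  then have "dist x' y' = u * dist q' r'"
    using u by (simp add: dist_norm)
  moreover have "dist (c (u * dist p q)) (e (u * dist p r)) \<le> dist x' y'"
    using cat c f e' d x y unfolding CAT0_space_def Let_def by blast
  ultimately show ?thesis using d by simp
qed

lemma CAT0_convex_dist:
  fixes c c' :: "real \<Rightarrow> 'a::metric_space"
  assumes cat: "CAT0_space TYPE('a)"
    and c: "geodesic_ray c" and c': "geodesic_ray c'"
    and u: "0 \<le> u" "u \<le> 1" and T: "T \<ge> 0"
  shows "dist (c (u * T)) (c' (u * T)) \<le> (1 - u) * dist (c 0) (c' 0) + u * dist (c T) (c' T)"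
proof -
  note g = geodesic_ray_imp_geodesic[OF c T] and g' = geodesic_ray_imp_geodesic[OF c' T]
  \<comment> \<open>The diagonal \<open>e\<close> is compared with \<open>c\<close> at its origin and with \<open>c'\<close> at its endpoint.\<close>
  obtain e where e: "geodesic (c 0) (c' T) e"
    using cat unfolding CAT0_space_def geodesic_space_def by blast
  let ?L = "dist (c 0) (c' T)"
  have 1: "dist (c (u * T)) (e (u * ?L)) \<le> u * dist (c T) (c' T)"
    using CAT0_intercept[OF cat g(2) e u] by (simp add: g(1))
  have "dist (e (?L - (1 - u) * ?L)) (c' (T - (1 - u) * T)) \<le> (1 - u) * dist (c 0) (c' 0)"
    using CAT0_intercept[OF cat geodesic_reverse[OF e] geodesic_reverse[OF g'(2)], of "1 - u"] u
    by (simp add: g'(1) dist_commute)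
  then have 2: "dist (e (u * ?L)) (c' (u * T)) \<le> (1 - u) * dist (c 0) (c' 0)"
    by (simp add: left_diff_distrib)
  show ?thesis
    using dist_triangle[of "c (u * T)" "c' (u * T)" "e (u * ?L)"] 1 2 by linarith
qed

text \<open>By convexity, the value at \<open>t\<close> exceeds the value at \<open>0\<close> by at most \<open>t / T\<close> times the
  value at any later time \<open>T\<close>; for asymptotic rays the latter is bounded, so this excess
  vanishes as \<open>T\<close> tends to infinity.\<close>

lemma CAT0_asymptotic_dist_le:
  fixes c c' :: "real \<Rightarrow> 'a::metric_space"
  assumes cat: "CAT0_space TYPE('a)"
    and asym: "(c, c') \<in> asymptotic_rel" and t: "t \<ge> 0"
  shows "dist (c t) (c' t) \<le> dist (c 0) (c' 0)"
proof -
  obtain a where c: "geodesic_ray c" "geodesic_ray c'"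
    and a: "a \<ge> 0" "\<And>s. s \<ge> 0 \<Longrightarrow> dist (c s) (c' s) \<le> a"
    using asym by (auto simp: asymptotic_rel_def)
  let ?D = "dist (c 0) (c' 0)"
  have bound: "dist (c t) (c' t) \<le> ?D + t * a / T" if T: "T \<ge> max t 1" for T
  proof -
    have u: "0 \<le> t / T" "t / T \<le> 1" using t T by (auto simp: divide_simps)
    have "dist (c t) (c' t) \<le> (1 - t / T) * ?D + t / T * dist (c T) (c' T)"
      using CAT0_convex_dist[OF cat c u, of T] T by simp
    also have "\<dots> \<le> 1 * ?D + t / T * a"
      using u a(2)[of T] T by (intro add_mono mult_mono) auto
    finally show ?thesis by simp
  qed
  have "((\<lambda>T. ?D + t * a / T) \<longlongrightarrow> ?D + 0) at_top"
    by (intro tendsto_intros tendsto_divide_0[OF tendsto_const]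
        filterlim_at_top_imp_at_infinity filterlim_ident)
  moreover have "eventually (\<lambda>T. dist (c t) (c' t) \<le> ?D + t * a / T) at_top"
    using eventually_ge_at_top[of "max t 1"] by eventually_elim (rule bound)
  ultimately show ?thesis
    using tendsto_lowerbound[OF _ _ trivial_limit_at_top_linorder] by fastforce
qed

lemma asymptotic_translate_of_stabilizer:
  assumes act: "isometric_action G \<phi>" and c: "geodesic_ray c"
    and h: "h \<in> stabilizer G (boundary_action \<phi>) (ray_end c)"
  shows "(c, \<phi> h \<circ> c) \<in> asymptotic_rel"
proof -
  have hG: "h \<in> carrier G" and fix_end: "boundary_action \<phi> h (ray_end c) = ray_end c"
    using h by (auto simp: stabilizer_def)
  have "c \<in> ray_end c"
    using c by (auto simp: ray_end_def asymptotic_rel_def)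
  then have "\<phi> h \<circ> c \<in> boundary_action \<phi> h (ray_end c)"
    by (simp add: boundary_action_def)
  then show ?thesis
    by (simp add: fix_end) (simp add: ray_end_def)
qed

theorem theorem5p1:
  fixes G :: "('g, 'm) monoid_scheme"
    and \<phi> :: "'g \<Rightarrow> 'a::metric_space \<Rightarrow> 'a"
    and M :: "'a set"
  assumes "proper_space TYPE('a)"
    and "CAT0_space TYPE('a)"
    and "isometric_action G \<phi>"
    and "M \<in> orbits G UNIV \<phi>"
    and "closed M"
    and "\<exists>b\<ge>0. \<forall>p\<in>M. \<forall>q\<in>M. \<exists>c. geodesic_ray c \<and> c 0 = p \<and>
           infdist q (c ` {0..}) \<le> b \<and>
           acts_transitively (stabilizer G (boundary_action \<phi>) (ray_end c)) \<phi> M"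
  shows "property_S G \<phi> M"
proof -
  obtain b where b: "b \<ge> 0"
    and rays: "\<And>p q. p \<in> M \<Longrightarrow> q \<in> M \<Longrightarrow> \<exists>c. geodesic_ray c \<and> c 0 = p \<and>
           infdist q (c ` {0..}) \<le> b \<and>
           acts_transitively (stabilizer G (boundary_action \<phi>) (ray_end c)) \<phi> M"
    using assms(6) by blast
  have "\<exists>g\<in>carrier G. \<phi> g p = p0 \<and> dist q (\<phi> g q) \<le> 2 * b + r"
    if M: "p0 \<in> M" "p \<in> M" "q \<in> M" and r: "dist p p0 \<le> r" for p0 p q r
  proof -
    obtain c where c: "geodesic_ray c" "c 0 = p" "infdist q (c ` {0..}) \<le> b"
      and trans: "acts_transitively (stabilizer G (boundary_action \<phi>) (ray_end c)) \<phi> M"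
      using rays M by blast
    obtain h where h: "h \<in> stabilizer G (boundary_action \<phi>) (ray_end c)" and hp: "\<phi> h p = p0"
      using trans M unfolding acts_transitively_def by blast
    have hG: "h \<in> carrier G" using h by (simp add: stabilizer_def)
    obtain t where t: "t \<ge> 0" "dist q (c t) \<le> b"
      using infdist_geodesic_ray_attained[OF c(1), of q] c(3) by auto
    have "dist (c t) (\<phi> h (c t)) \<le> r"
      using CAT0_asymptotic_dist_le[OF assms(2)
          asymptotic_translate_of_stabilizer[OF assms(3) c(1) h] t(1)] r
      by (simp add: c(2) hp)
    moreover have "dist (\<phi> h (c t)) (\<phi> h q) \<le> b"
      using assms(3) hG t(2) by (simp add: isometric_action_def dist_commute)
    ultimately have "dist q (\<phi> h q) \<le> 2 * b + r"
      using t(2) dist_triangle[of q "\<phi> h q" "c t"]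
        dist_triangle[of "c t" "\<phi> h q" "\<phi> h (c t)"] by linarith
    then show ?thesis using hG hp by blast
  qed
  moreover have "2 * b + r \<ge> 0" if "r \<ge> 0" for r
    using b that by simp
  ultimately show ?thesis
    unfolding property_S_def by blast
qed

end
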